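(* Let $A:[0,1]\to\mathbb{R}^{n\times n}$ be a measurable matrix function whose entries belong to $L^\infty([0,1])$. Suppose that $A(t)$ is a totally positive Hankel matrix for almost every $t\in[0,1]$. Then the matrix $\bar A:=\int_0^1A(t)\,\mathrm{d}t$ is totally positive.
   Context: A matrix is totally positive if all its minors (of all orders) are positive. A matrix $A=(a_{ij})\in\mathbb{R}^{n\times n}$ is a Hankel matrix if $a_{ij}=a_{pq}$ whenever $i+j=p+q$. Measurability, "almost every" and integration (entrywise) are with respect to Lebesgue measure on $[0,1]$. *)

theory Defs
  imports
    "HOL-Analysis.Analysis"
    "Jordan_Normal_Form.Determinant"
    "Jordan_Normal_Form.DL_Submatrix"
begin

(* HOL-Analysis also provides det for type-indexed matrices, hence the qualified name.
   Matrix indices are 0-based. *)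

definition totally_positive :: "real mat \<Rightarrow> bool" where
  "totally_positive A \<longleftrightarrow>
     (\<forall>I J. I \<subseteq> {..<dim_row A} \<and> J \<subseteq> {..<dim_col A} \<and> card I = card J \<and> I \<noteq> {} \<longrightarrow>
        0 < Determinant.det (submatrix A I J))"

definition hankel_mat :: "real mat \<Rightarrow> bool" where
  "hankel_mat A \<longleftrightarrow>
     square_mat A \<and>
     (\<forall>i<dim_row A. \<forall>j<dim_row A. \<forall>p<dim_row A. \<forall>q<dim_row A.
        i + j = p + q \<longrightarrow> A $$ (i, j) = A $$ (p, q))"

(* Membership is on the level of functions, not of classes modulo almost everywhere equality. *)
definition Linfty :: "'a measure \<Rightarrow> ('a \<Rightarrow> real) set" where
  "Linfty M = {f \<in> borel_measurable M. \<exists>C. AE x in M. \<bar>f x\<bar> \<le> C}"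

definition mat_integral :: "'a measure \<Rightarrow> nat \<Rightarrow> ('a \<Rightarrow> real mat) \<Rightarrow> real mat" where
  "mat_integral M n A = Matrix.mat n n (\<lambda>(i, j). LINT t|M. A t $$ (i, j))"

end

theory Submission
  imports Defs
begin

text \<open>Total positivity itself is not preserved by averaging, but a contiguous submatrix of a Hankel
  matrix is symmetric, and if all its minors are positive, it is positive definite by Sylvester's
  criterion. Positive definiteness is a convex condition, so it passes to the integral; hence all
  contiguous minors of the integral are positive. Fekete's criterion extends this from contiguous
  to arbitrary minors.\<close>

section \<open>Determinants of matrices given by index functions\<close>

text \<open>With index functions a choice of rows or columns is a mere composition and no carrier
  conditions arise. Only values at indices below \<open>n\<close> matter.\<close>

definition det_fun :: "nat \<Rightarrow> (nat \<Rightarrow> nat \<Rightarrow> real) \<Rightarrow> real" where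
  "det_fun n f = Determinant.det (Matrix.mat n n (\<lambda>(i, j). f i j))"

lemma det_fun_cong:
  assumes "\<And>i j. i < n \<Longrightarrow> j < n \<Longrightarrow> f i j = g i j"
  shows "det_fun n f = det_fun n g"
  unfolding det_fun_def by (intro arg_cong[of _ _ Determinant.det] eq_matI) (auto simp: assms)

lemma det_fun_transpose: "det_fun n (\<lambda>i j. f j i) = det_fun n f"
proof -
  have "Matrix.mat n n (\<lambda>(i, j). f j i) = transpose_mat (Matrix.mat n n (\<lambda>(i, j). f i j))"
    by (intro eq_matI) auto
  then show ?thesis
    unfolding det_fun_def by (simp add: Determinant.det_transpose[of _ n])
qed

lemma det_fun_expand_column:
  assumes "j < Suc n"
  shows "det_fun (Suc n) f = (\<Sum>i<Suc n. f i j *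
    ((-1) ^ (i + j) * det_fun n (\<lambda>i' j'. f (insert_index i i') (insert_index j j'))))"
proof -
  let ?A = "Matrix.mat (Suc n) (Suc n) (\<lambda>(i, j). f i j)"
  have *: "mat_delete ?A i j = Matrix.mat n n (\<lambda>(i', j'). f (insert_index i i') (insert_index j j'))"
    if "i < Suc n" for i
    using that assms by (intro eq_matI) (auto simp: mat_delete_def insert_index_def)
  show ?thesis
    unfolding det_fun_def using assms
    by (subst laplace_expansion_column[of _ "Suc n" j]) (auto simp: cofactor_def * intro!: sum.cong)
qed

lemma det_fun_expand_row:
  assumes "i < Suc n"
  shows "det_fun (Suc n) f = (\<Sum>j<Suc n. f i j *
    ((-1) ^ (i + j) * det_fun n (\<lambda>i' j'. f (insert_index i i') (insert_index j j'))))"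
proof -
  have "det_fun (Suc n) f = det_fun (Suc n) (\<lambda>i j. f j i)"
    by (rule det_fun_transpose[symmetric])
  also have "\<dots> = (\<Sum>j<Suc n. f i j *
    ((-1) ^ (j + i) * det_fun n (\<lambda>i' j'. f (insert_index i j') (insert_index j i'))))"
    by (rule det_fun_expand_column[OF assms])
  also have "\<dots> = (\<Sum>j<Suc n. f i j *
    ((-1) ^ (i + j) * det_fun n (\<lambda>i' j'. f (insert_index i i') (insert_index j j'))))"
  proof (intro sum.cong refl)
    fix j
    show "f i j * ((-1) ^ (j + i) * det_fun n (\<lambda>i' j'. f (insert_index i j') (insert_index j i'))) =
        f i j * ((-1) ^ (i + j) * det_fun n (\<lambda>i' j'. f (insert_index i i') (insert_index j j')))"
      using det_fun_transpose[of n "\<lambda>i' j'. f (insert_index i i') (insert_index j j')"]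
      by (simp add: add.commute)
  qed
  finally show ?thesis .
qed

lemma det_fun_identical_columns:
  assumes "j \<noteq> k" "j < n" "k < n" "\<And>i. i < n \<Longrightarrow> f i j = f i k"
  shows "det_fun n f = 0"
  unfolding det_fun_def
  using assms by (intro det_identical_columns[of _ n j k]) (auto intro!: eq_vecI)

lemma det_fun_identical_rows:
  assumes "i \<noteq> k" "i < n" "k < n" "\<And>j. j < n \<Longrightarrow> f i j = f k j"
  shows "det_fun n f = 0"
  using det_fun_identical_columns[of i k n "\<lambda>i j. f j i"] assms
  by (subst det_fun_transpose[symmetric]) auto

lemma det_fun_1: "det_fun (Suc 0) f = f 0 0"
  unfolding det_fun_def by (subst det_single) auto

text \<open>One step of Gaussian elimination: subtracting multiples of row 0 clears column 0 below
  the pivot. The multipliers form a unit lower triangular factor, and expanding the other factor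
  along column 0 leaves a single term.\<close>

lemma det_fun_Schur:
  assumes "f 0 0 \<noteq> 0"
  shows "det_fun (Suc n) f =
    f 0 0 * det_fun n (\<lambda>i j. f (Suc i) (Suc j) - f (Suc i) 0 * f 0 (Suc j) / f 0 0)"
proof -
  let ?A = "Matrix.mat (Suc n) (Suc n) (\<lambda>(i, j). f i j)"
  let ?l = "\<lambda>i j. if i = j then 1 else if j = 0 then f i 0 / f 0 0 else 0"
  let ?u = "\<lambda>i j. if i = 0 then f 0 j else f i j - f i 0 * f 0 j / f 0 0"
  let ?L = "Matrix.mat (Suc n) (Suc n) (\<lambda>(i, j). ?l i j)"
  let ?U = "Matrix.mat (Suc n) (Suc n) (\<lambda>(i, j). ?u i j)"
  have "?A = ?L * ?U"
  proof (rule eq_matI)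
    fix i j assume ij: "i < dim_row (?L * ?U)" "j < dim_col (?L * ?U)"
    have "(?L * ?U) $$ (i, j) = (\<Sum>k<Suc n. ?l i k * ?u k j)"
      using ij by (simp add: scalar_prod_def lessThan_atLeast0)
    \<comment> \<open>Row \<open>i\<close> of the lower factor vanishes outside columns 0 and
      \<open>i\<close>.\<close>
    also have "\<dots> = (\<Sum>k\<in>{0, i}. ?l i k * ?u k j)"
      using ij by (intro sum.mono_neutral_right) auto
    also have "\<dots> = f i j" using assms by (cases "i = 0") auto
    finally show "?A $$ (i, j) = (?L * ?U) $$ (i, j)" using ij by simp
  qed auto
  then have "det_fun (Suc n) f = Determinant.det ?L * Determinant.det ?U"
    unfolding det_fun_def by (simp add: Determinant.det_mult[of _ "Suc n"])
  also have "Determinant.det ?L = 1"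
    by (subst Determinant.det_lower_triangular[of "Suc n"])
       (auto simp: prod_list_diag_prod intro!: prod.neutral)
  also have "Determinant.det ?U = det_fun (Suc n) ?u"
    by (simp add: det_fun_def)
  also have "\<dots> = f 0 0 * det_fun n (\<lambda>i j. f (Suc i) (Suc j) - f (Suc i) 0 * f 0 (Suc j) / f 0 0)"
    using assms by (subst det_fun_expand_column[of 0])
      (auto simp: sum.lessThan_Suc_shift simp del: sum.lessThan_Suc intro!: det_fun_cong)
  finally show ?thesis by simp
qed

section \<open>Sylvester's criterion\<close>

definition pos_def_fun :: "nat \<Rightarrow> (nat \<Rightarrow> nat \<Rightarrow> real) \<Rightarrow> bool" where
  "pos_def_fun n f \<longleftrightarrow>
     (\<forall>x. (\<exists>i<n. x i \<noteq> 0) \<longrightarrow> 0 < (\<Sum>i<n. \<Sum>j<n. f i j * x i * x j))"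

text \<open>Completing the square in \<open>x 0\<close>: what remains is the quadratic form of the
  Schur complement.\<close>

lemma quadratic_form_Schur:
  fixes f :: "nat \<Rightarrow> nat \<Rightarrow> real"
  assumes "f 0 0 \<noteq> 0" and sym: "\<And>i j. i \<le> n \<Longrightarrow> j \<le> n \<Longrightarrow> f i j = f j i"
  shows "(\<Sum>i<Suc n. \<Sum>j<Suc n. f i j * x i * x j) =
    f 0 0 * (x 0 + (\<Sum>i<n. f 0 (Suc i) * x (Suc i)) / f 0 0)\<^sup>2 +
    (\<Sum>i<n. \<Sum>j<n. (f (Suc i) (Suc j) - f (Suc i) 0 * f 0 (Suc j) / f 0 0) * x (Suc i) * x (Suc j))"
proof -
  define b where "b = (\<Sum>i<n. f 0 (Suc i) * x (Suc i))"
  define q where "q = (\<Sum>i<n. \<Sum>j<n. f (Suc i) (Suc j) * x (Suc i) * x (Suc j))"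
  have b': "(\<Sum>i<n. f (Suc i) 0 * x (Suc i)) = b"
    unfolding b_def by (intro sum.cong refl) (simp add: sym)
  have "(\<Sum>i<n. \<Sum>j<n. (f (Suc i) 0 * x (Suc i)) * (f 0 (Suc j) * x (Suc j))) = b * b"
    unfolding sum_product[symmetric] b' b_def ..
  then have 1: "(\<Sum>i<n. \<Sum>j<n. (f (Suc i) (Suc j) - f (Suc i) 0 * f 0 (Suc j) / f 0 0) *
      x (Suc i) * x (Suc j)) = q - b * b / f 0 0"
    unfolding q_def
    by (simp add: left_diff_distrib right_diff_distrib sum_subtractf mult_ac flip: sum_divide_distrib)
  have "(\<Sum>i<Suc n. \<Sum>j<Suc n. f i j * x i * x j) =
      f 0 0 * x 0 * x 0 + (\<Sum>j<n. f 0 (Suc j) * x 0 * x (Suc j)) +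
      ((\<Sum>i<n. f (Suc i) 0 * x (Suc i) * x 0) + q)"
    unfolding q_def sum.lessThan_Suc_shift by (simp add: sum.distrib)
  also have "(\<Sum>j<n. f 0 (Suc j) * x 0 * x (Suc j)) = x 0 * b"
    unfolding b_def by (simp add: sum_distrib_left mult_ac)
  also have "(\<Sum>i<n. f (Suc i) 0 * x (Suc i) * x 0) = b * x 0"
    unfolding b'[symmetric] by (simp add: sum_distrib_right)
  finally show ?thesis
    unfolding 1 b_def[symmetric] using assms(1)
    by (simp add: power2_eq_square field_simps)
qed

lemma pos_def_fun_Schur:
  assumes "0 < f 0 0" and sym: "\<And>i j. i \<le> n \<Longrightarrow> j \<le> n \<Longrightarrow> f i j = f j i"
  shows "pos_def_fun (Suc n) f \<longleftrightarrow>
    pos_def_fun n (\<lambda>i j. f (Suc i) (Suc j) - f (Suc i) 0 * f 0 (Suc j) / f 0 0)"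
    (is "_ \<longleftrightarrow> pos_def_fun n ?S")
proof
  have q: "(\<Sum>i<Suc n. \<Sum>j<Suc n. f i j * x i * x j) =
    f 0 0 * (x 0 + (\<Sum>i<n. f 0 (Suc i) * x (Suc i)) / f 0 0)\<^sup>2 +
    (\<Sum>i<n. \<Sum>j<n. ?S i j * x (Suc i) * x (Suc j))" for x
    by (rule quadratic_form_Schur) (use assms in auto)
  show "pos_def_fun n ?S" if pd: "pos_def_fun (Suc n) f"
    unfolding pos_def_fun_def
  proof (intro allI impI)
    fix y :: "nat \<Rightarrow> real" assume "\<exists>i<n. y i \<noteq> 0"
    then obtain i where i: "i < n" "y i \<noteq> 0" by auto
    \<comment> \<open>The entry at 0 is chosen to make the completed square vanish.\<close>
    let ?x = "case_nat (- (\<Sum>i<n. f 0 (Suc i) * y i) / f 0 0) y"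
    have "0 < (\<Sum>i<Suc n. \<Sum>j<Suc n. f i j * ?x i * ?x j)"
      using pd i unfolding pos_def_fun_def by (elim allE[of _ ?x]) (force intro: exI[of _ "Suc i"])
    then show "0 < (\<Sum>i<n. \<Sum>j<n. ?S i j * y i * y j)"
      unfolding q by simp
  qed
  show "pos_def_fun (Suc n) f" if pd: "pos_def_fun n ?S"
    unfolding pos_def_fun_def
  proof (intro allI impI)
    fix x :: "nat \<Rightarrow> real" assume x: "\<exists>i<Suc n. x i \<noteq> 0"
    show "0 < (\<Sum>i<Suc n. \<Sum>j<Suc n. f i j * x i * x j)"
    proof (cases "\<exists>i<n. x (Suc i) \<noteq> 0")
      case True
      then have "0 < (\<Sum>i<n. \<Sum>j<n. ?S i j * x (Suc i) * x (Suc j))"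
        using pd unfolding pos_def_fun_def by (elim allE[of _ "\<lambda>i. x (Suc i)"]) auto
      then show ?thesis
        unfolding q using assms(1) by (intro add_nonneg_pos) auto
    next
      case False
      then have "x 0 \<noteq> 0" using x by (metis less_Suc_eq_0_disj)
      with False show ?thesis unfolding q using assms(1) by simp
    qed
  qed
qed

text \<open>Induction via Schur complements: for positive \<open>f 0 0\<close>, the leading minor of
  order \<open>Suc k\<close> is \<open>f 0 0\<close> times the leading minor of order
  \<open>k\<close> of the complement. Otherwise both sides fail.\<close>

theorem Sylvester_criterion:
  assumes "\<And>i j. i < n \<Longrightarrow> j < n \<Longrightarrow> f i j = f j i"
  shows "pos_def_fun n f \<longleftrightarrow> (\<forall>k\<in>{1..n}. 0 < det_fun k f)"
  using assms
proof (induction n arbitrary: f)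
  case 0
  then show ?case by (simp add: pos_def_fun_def)
next
  case (Suc n)
  let ?S = "\<lambda>i j. f (Suc i) (Suc j) - f (Suc i) 0 * f 0 (Suc j) / f 0 0"
  have split: "{1..Suc n} = insert 1 (Suc ` {1..n})"
    by (auto simp: image_Suc_atLeastAtMost)
  show ?case
  proof (cases "0 < f 0 0")
    case True
    have "pos_def_fun (Suc n) f \<longleftrightarrow> pos_def_fun n ?S"
      using Suc.prems True by (intro pos_def_fun_Schur) auto
    also have "\<dots> \<longleftrightarrow> (\<forall>k\<in>{1..n}. 0 < det_fun k ?S)"
      using Suc.prems by (intro Suc.IH) (simp add: mult.commute)
    also have "\<dots> \<longleftrightarrow> (\<forall>k\<in>{1..n}. 0 < det_fun (Suc k) f)"
      using True by (simp add: det_fun_Schur zero_less_mult_iff)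
    also have "\<dots> \<longleftrightarrow> (\<forall>k\<in>{1..Suc n}. 0 < det_fun k f)"
      unfolding split using True by (simp add: det_fun_1 del: image_Suc_atLeastAtMost)
    finally show ?thesis .
  next
    case False
    \<comment> \<open>The first unit vector refutes positive definiteness.\<close>
    have "(\<Sum>i<Suc n. \<Sum>j<Suc n. f i j * of_bool (i = 0) * of_bool (j = 0)) = f 0 0"
      unfolding sum.lessThan_Suc_shift by simp
    then have "\<not> pos_def_fun (Suc n) f"
      unfolding pos_def_fun_def using False
      by (intro notI, elim allE[of _ "\<lambda>i. of_bool (i = 0)"]) auto
    moreover have "\<not> (\<forall>k\<in>{1..Suc n}. 0 < det_fun k f)"
      unfolding split using False by (simp add: det_fun_1 del: image_Suc_atLeastAtMost)
    ultimately show ?thesis by blast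
  qed
qed

section \<open>Fekete's criterion\<close>

text \<open>The alternating maximal minors of a matrix with \<open>Suc m\<close> rows and
  \<open>m\<close> columns are the coefficients of a linear relation among its rows: appending a
  copy of column \<open>j\<close> gives a singular square matrix, which is expanded along the new
  column.\<close>

lemma sum_maximal_minors_eq_0:
  assumes "j < m"
  shows "(\<Sum>q<Suc m. (-1) ^ q * det_fun m (\<lambda>i. B (insert_index q i)) * B q j) = 0"
proof -
  let ?f = "\<lambda>i k. B i (if k = m then j else k)"
  have "0 = det_fun (Suc m) ?f"
    using assms by (intro det_fun_identical_columns[symmetric, of m j]) auto
  also have "\<dots> = (\<Sum>q<Suc m. B q j * ((-1) ^ (q + m) * det_fun m (\<lambda>i. B (insert_index q i))))"
    by (subst det_fun_expand_column[of m]) (auto intro!: sum.cong det_fun_cong simp del: sum.lessThan_Suc)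
  also have "\<dots> = (-1) ^ m *
      (\<Sum>q<Suc m. (-1) ^ q * det_fun m (\<lambda>i. B (insert_index q i)) * B q j)"
    by (simp add: sum_distrib_left power_add mult_ac del: sum.lessThan_Suc)
  finally show ?thesis by simp
qed

definition insert_at :: "nat \<Rightarrow> 'a \<Rightarrow> (nat \<Rightarrow> 'a) \<Rightarrow> nat \<Rightarrow> 'a" where
  "insert_at t q g i = (if i < t then g i else if i = t then q else g (i - 1))"

lemma insert_at_insert_index [simp]: "insert_at t q g (insert_index t i) = g i"
  by (auto simp: insert_at_def insert_index_def)

text \<open>The sum does not involve \<open>t\<close>: inserting the row \<open>B q\<close> at
  different positions gives the same linear functional of that row up to the sign
  \<open>(-1) ^ t\<close>.\<close>

lemma det_fun_insert_at:
  assumes "t \<le> n"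
  shows "det_fun (Suc n) (\<lambda>i. B (insert_at t q g i)) =
    (-1) ^ t * (\<Sum>k<Suc n. B q k * ((-1) ^ k * det_fun n (\<lambda>i j. B (g i) (insert_index k j))))"
  using assms by (subst det_fun_expand_row[of t])
    (auto simp: insert_at_def[of t q g t] power_add sum_distrib_left mult_ac simp del: sum.lessThan_Suc)

text \<open>With \<open>D\<^sub>q\<close> the maximal minor omitting row \<open>q\<close> and \<open>E\<^sub>q\<^sub>r\<close> the minor of the first \<open>m - 1\<close>
  columns omitting rows \<open>q\<close> and \<open>r\<close>, where \<open>m = N + 2\<close>, the proof rests on the identity
  \<open>D\<^sub>p E\<^sub>0\<^sub>m = D\<^sub>0 E\<^sub>p\<^sub>m + D\<^sub>m E\<^sub>0\<^sub>p\<close>. It is obtained by applying the functional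
  \<open>v \<mapsto> det (v, rows other than 0, p, m)\<close> to the linear relation among the rows.\<close>

lemma maximal_minor_pos_interpolate:
  fixes B :: "nat \<Rightarrow> nat \<Rightarrow> real"
  assumes p: "0 < p" "p < Suc (Suc N)"
    and minors: "\<And>u. strict_mono_on {..<Suc N} u \<Longrightarrow> u ` {..<Suc N} \<subseteq> {..Suc (Suc N)} \<Longrightarrow>
      0 < det_fun (Suc N) (\<lambda>i. B (u i))"
    and first: "0 < det_fun (Suc (Suc N)) (\<lambda>i. B (insert_index 0 i))"
    and last: "0 < det_fun (Suc (Suc N)) (\<lambda>i. B (insert_index (Suc (Suc N)) i))"
  shows "0 < det_fun (Suc (Suc N)) (\<lambda>i. B (insert_index p i))"
proof -
  define m where "m = Suc (Suc N)"
  define D where "D q = det_fun m (\<lambda>i. B (insert_index q i))" for q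
  \<comment> \<open>For \<open>i < N\<close>, \<open>g\<close> lists in increasing order the rows
    other than 0, \<open>p\<close> and \<open>m\<close>; \<open>G\<close> is the functional that
    puts a row in front of them.\<close>
  define g where "g i = (if Suc i < p then Suc i else Suc (Suc i))" for i
  define G where "G q = (\<Sum>k<Suc N. B q k * ((-1) ^ k * det_fun N (\<lambda>i j. B (g i) (insert_index k j))))" for q
  have GE: "det_fun (Suc N) (\<lambda>i. B (insert_at t q g i)) = (-1) ^ t * G q" if "t \<le> N" for t q
    unfolding G_def by (rule det_fun_insert_at[OF that])
  have G_g: "G (g i) = 0" if "i < N" for i
  proof -
    \<comment> \<open>The inserted row already occurs at position \<open>Suc i\<close>.\<close>
    have "det_fun (Suc N) (\<lambda>j. B (insert_at 0 (g i) g j)) = 0"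
      using that by (intro det_fun_identical_rows[of 0 "Suc i"]) (auto simp: insert_at_def)
    then show ?thesis by (simp add: GE)
  qed
  have G_other: "G q = 0" if "q < Suc m" "q \<notin> {0, p, m}" for q
  proof (cases "q < p")
    case True
    then have "g (q - 1) = q" "q - 1 < N" using that p by (auto simp: g_def m_def)
    then show ?thesis using G_g[of "q - 1"] by simp
  next
    case False
    then have "g (q - 2) = q" "q - 2 < N" using that p by (auto simp: g_def m_def)
    then show ?thesis using G_g[of "q - 2"] by simp
  qed
  have "(\<Sum>q<Suc m. (-1) ^ q * D q * G q) =
      (\<Sum>k<Suc N. (\<Sum>q<Suc m. (-1) ^ q * D q * B q k) *
        ((-1) ^ k * det_fun N (\<lambda>i j. B (g i) (insert_index k j))))"
    unfolding G_def sum_distrib_left sum_distrib_right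
    by (subst sum.swap) (simp add: mult_ac del: sum.lessThan_Suc)
  also have "\<dots> = 0"
    unfolding D_def
    by (intro sum.neutral ballI) (simp add: sum_maximal_minors_eq_0 m_def del: sum.lessThan_Suc)
  finally have "0 = (\<Sum>q<Suc m. (-1) ^ q * D q * G q)" ..
  also have "\<dots> = (\<Sum>q\<in>{0, p, m}. (-1) ^ q * D q * G q)"
    using p G_other by (intro sum.mono_neutral_right) (auto simp: m_def)
  \<comment> \<open>Here \<open>(-1) ^ m\<close> equals \<open>(-1) ^ N\<close> because
    \<open>m = N + 2\<close>. Moving the \<open>p\<close> term across then turns its sign into
    \<open>(-1) ^ (p - 1)\<close>.\<close>
  also have "\<dots> = D 0 * G 0 + (-1) ^ p * D p * G p + (-1) ^ N * D m * G m"
    using p by (simp add: m_def)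
  finally have rel: "D p * ((-1) ^ (p - 1) * G p) = D 0 * G 0 + D m * ((-1) ^ N * G m)"
    using p by (cases p) (auto simp: algebra_simps)
  \<comment> \<open>The positions 0, \<open>p - 1\<close> and \<open>N\<close> are where 0,
    \<open>p\<close> and \<open>m\<close> fit into the increasing list \<open>g\<close>, so each
    inserted list is increasing and \<open>minors\<close> applies.\<close>
  have E: "0 < (-1) ^ t * G q"
    if "(t, q) \<in> {(0, 0), (p - 1, p), (N, m)}" for t q
  proof -
    have "0 < det_fun (Suc N) (\<lambda>i. B (insert_at t q g i))"
      using that p
      by (intro minors) (auto simp: strict_mono_on_def insert_at_def g_def m_def)
    then show ?thesis using that p GE[of t q] by auto
  qed
  have "0 < D p * ((-1) ^ (p - 1) * G p)"
    unfolding rel using E[of 0 0] E[of N m] first last by (simp add: D_def m_def add_pos_pos)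
  moreover have "0 < (-1) ^ (p - 1) * G p" using E by simp
  ultimately have "0 < D p" by (rule zero_less_mult_pos2)
  then show ?thesis by (simp add: D_def m_def)
qed

text \<open>Passes from order \<open>m\<close> to order \<open>Suc m\<close> with the columns fixed,
  by induction on the spread \<open>r m - r 0\<close>. A selection without gaps is contiguous; one
  with a gap is reduced by interpolation to two selections of smaller spread and to minors of order
  \<open>m\<close>.\<close>

lemma row_minors_pos_of_contiguous:
  fixes a :: "nat \<Rightarrow> nat \<Rightarrow> real"
  assumes small: "\<And>r. strict_mono_on {..<m} r \<Longrightarrow> r ` {..<m} \<subseteq> {..<n} \<Longrightarrow>
      0 < det_fun m (\<lambda>i. a (r i))"
    and contiguous: "\<And>p. p + Suc m \<le> n \<Longrightarrow> 0 < det_fun (Suc m) (\<lambda>i. a (p + i))"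
    and r: "strict_mono_on {..<Suc m} r" "r ` {..<Suc m} \<subseteq> {..<n}"
  shows "0 < det_fun (Suc m) (\<lambda>i. a (r i))"
  using r
proof (induction "r m - r 0" arbitrary: r rule: less_induct)
  case less
  have mono: "r i < r j" if "i < j" "j \<le> m" for i j
    using less.prems(1) that by (auto simp: strict_mono_on_def)
  have range: "r i < n" if "i \<le> m" for i
    using less.prems(2) that by (auto simp: image_subset_iff)
  show ?case
  proof (cases "\<forall>i<m. r (Suc i) = Suc (r i)")
    case True
    have eq: "r i = r 0 + i" if "i \<le> m" for i
      using that True by (induction i) auto
    have "r 0 + Suc m \<le> n" using range[of m] eq[of m] by simp
    then have "0 < det_fun (Suc m) (\<lambda>i. a (r 0 + i))" by (rule contiguous)
    also have "det_fun (Suc m) (\<lambda>i. a (r 0 + i)) = det_fun (Suc m) (\<lambda>i. a (r i))"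
      by (rule det_fun_cong) (simp add: eq[symmetric])
    finally show ?thesis .
  next
    case False
    then obtain l where l: "l < m" "r (Suc l) \<noteq> Suc (r l)" by auto
    then have gap: "Suc (r l) < r (Suc l)" using mono[of l "Suc l"] by simp
    obtain N where m: "m = Suc N" using l by (cases m) auto
    \<comment> \<open>\<open>s\<close> is \<open>r\<close> with one index of the gap added; dropping its first or its last index leaves a
      selection of smaller spread.\<close>
    define s where "s = insert_at (Suc l) (Suc (r l)) r"
    have s_step: "s i < s (Suc i)" if "i < Suc m" for i
      using that gap mono[of "i - 1" i] mono[of i "Suc i"] l
      by (auto simp: s_def insert_at_def less_Suc_eq)
    have s_mono: "s i < s j" if "i < j" "j \<le> Suc m" for i j
      using that
    proof (induction j)
      case (Suc j)
      then show ?case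
        using s_step[of j] by (cases "i = j") auto
    qed simp
    have s0: "s 0 = r 0" and sm: "s (Suc m) = r m"
      using l by (auto simp: s_def insert_at_def)
    have s_range: "s i < n" if "i \<le> Suc m" for i
      using s_mono[of i "Suc m"] sm range[of m] that by (cases "i = Suc m") auto
    have sub: "strict_mono_on {..<k} (\<lambda>i. s (u i))" "(\<lambda>i. s (u i)) ` {..<k} \<subseteq> {..<n}"
      if "strict_mono_on {..<k} u" "u ` {..<k} \<subseteq> {..Suc m}" for u k
      using that s_mono s_range by (auto simp: strict_mono_on_def image_subset_iff)
    have skip: "strict_mono_on {..<Suc m} (insert_index q)" "insert_index q ` {..<Suc m} \<subseteq> {..Suc m}" for q
      by (auto simp: strict_mono_on_def insert_index_def)
    \<comment> \<open>Skipping position \<open>Suc l\<close> of \<open>s\<close> removes the added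
      index and recovers \<open>r\<close>. This position is interior, as the interpolation
      requires.\<close>
    have "0 < det_fun (Suc (Suc N)) (\<lambda>i. a (s (insert_index (Suc l) i)))"
    proof (rule maximal_minor_pos_interpolate[where B = "\<lambda>i. a (s i)"])
      show "0 < det_fun (Suc N) (\<lambda>i. a (s (u i)))"
        if "strict_mono_on {..<Suc N} u" "u ` {..<Suc N} \<subseteq> {..Suc (Suc N)}" for u
        using small[of "\<lambda>i. s (u i)"] sub[of m u] that by (simp add: m)
      have "s (Suc m) - s 1 < r m - r 0"
        using s_mono[of 0 1] s_mono[of 1 "Suc m"] s0 sm m by simp
      then show "0 < det_fun (Suc (Suc N)) (\<lambda>i. a (s (insert_index 0 i)))"
        using less.hyps[of "\<lambda>i. s (insert_index 0 i)"] sub[OF skip[of 0]] by (simp add: m)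
      have "s m - s 0 < r m - r 0"
        using s_mono[of m "Suc m"] s_mono[of 0 m] s0 sm m by simp
      then show "0 < det_fun (Suc (Suc N)) (\<lambda>i. a (s (insert_index (Suc (Suc N)) i)))"
        using less.hyps[of "\<lambda>i. s (insert_index (Suc m) i)"] sub[OF skip[of "Suc m"]] by (simp add: m)
    qed (use l m in auto)
    then show ?thesis by (simp add: s_def m)
  qed
qed

text \<open>Two passes, each by induction on the order: first the rows become arbitrary while the
  columns stay contiguous, then, after transposing, the columns become arbitrary for any fixed
  choice of rows.\<close>

theorem Fekete_criterion:
  fixes a :: "nat \<Rightarrow> nat \<Rightarrow> real"
  assumes contiguous: "\<And>k p q. 0 < k \<Longrightarrow> p + k \<le> n \<Longrightarrow> q + k \<le> n \<Longrightarrow>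
      0 < det_fun k (\<lambda>i j. a (p + i) (q + j))"
    and r: "strict_mono_on {..<k} r" "r ` {..<k} \<subseteq> {..<n}"
    and c: "strict_mono_on {..<k} c" "c ` {..<k} \<subseteq> {..<n}"
  shows "0 < det_fun k (\<lambda>i j. a (r i) (c j))"
proof -
  \<comment> \<open>The empty determinant is 1, so both inductions can start at order 0.\<close>
  have det0: "0 < det_fun 0 f" for f
    by (simp add: det_fun_def)
  have rows: "0 < det_fun k (\<lambda>i j. a (r i) (q + j))"
    if "strict_mono_on {..<k} r" "r ` {..<k} \<subseteq> {..<n}" "q + k \<le> n" for k r q
    using that
  proof (induction k arbitrary: r)
    case (Suc k)
    show ?case
      by (rule row_minors_pos_of_contiguous[where a = "\<lambda>i j. a i (q + j)" and n = n])
         (use Suc contiguous in auto)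
  qed (rule det0)
  show ?thesis
    using r c
  proof (induction k arbitrary: r c)
    case (Suc k)
    have "0 < det_fun (Suc k) (\<lambda>j i. a (r i) (c j))"
    proof (rule row_minors_pos_of_contiguous[where a = "\<lambda>j i. a (r i) j" and n = n])
      fix c' :: "nat \<Rightarrow> nat"
      assume c': "strict_mono_on {..<k} c'" "c' ` {..<k} \<subseteq> {..<n}"
      have "0 < det_fun k (\<lambda>i j. a (r i) (c' j))"
        using Suc.prems by (intro Suc.IH c') (auto simp: strict_mono_on_def image_subset_iff)
      then show "0 < det_fun k (\<lambda>j i. a (r i) (c' j))"
        using det_fun_transpose[of k "\<lambda>i j. a (r i) (c' j)"] by simp
    next
      fix q assume "q + Suc k \<le> n"
      then have "0 < det_fun (Suc k) (\<lambda>i j. a (r i) (q + j))"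
        using Suc.prems by (intro rows)
      then show "0 < det_fun (Suc k) (\<lambda>j i. a (r i) (q + j))"
        using det_fun_transpose[of "Suc k" "\<lambda>i j. a (r i) (q + j)"] by simp
    qed (use Suc.prems in auto)
    then show ?case
      using det_fun_transpose[of "Suc k" "\<lambda>i j. a (r i) (c j)"] by simp
  qed (rule det0)
qed

section \<open>Totally positive matrices and integration\<close>

lemma det_submatrix:
  assumes "I \<subseteq> {..<dim_row A}" "J \<subseteq> {..<dim_col A}" "card I = card J"
  shows "Determinant.det (submatrix A I J) = det_fun (card I) (\<lambda>i j. A $$ (pick I i, pick J j))"
proof -
  have "{i. i < dim_row A \<and> i \<in> I} = I" "{j. j < dim_col A \<and> j \<in> J} = J"
    using assms by auto
  then show ?thesis
    by (simp add: submatrix_def det_fun_def assms)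
qed

lemma pick_atLeastLessThan:
  assumes "i < k"
  shows "pick {p..<p + k} i = p + i"
proof -
  have "{a \<in> {p..<p + k}. a < p + i} = {p..<p + i}" using assms by auto
  then show ?thesis using pick_card_in_set[of "p + i" "{p..<p + k}"] assms by simp
qed

lemma totally_positive_contiguous_minor:
  assumes "totally_positive A" "0 < k" "p + k \<le> dim_row A" "q + k \<le> dim_col A"
  shows "0 < det_fun k (\<lambda>i j. A $$ (p + i, q + j))"
proof -
  have sub: "{p..<p + k} \<subseteq> {..<dim_row A}" "{q..<q + k} \<subseteq> {..<dim_col A}"
    using assms by auto
  have "0 < Determinant.det (submatrix A {p..<p + k} {q..<q + k})"
    using assms(1,2) sub unfolding totally_positive_def by auto
  also have "\<dots> = det_fun k (\<lambda>i j. A $$ (p + i, q + j))"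
    using sub by (auto simp: det_submatrix pick_atLeastLessThan intro!: det_fun_cong)
  finally show ?thesis .
qed

text \<open>\<open>pick\<close> enumerates an index set increasingly, which brings an arbitrary
  minor into the form of Fekete's criterion.\<close>

lemma totally_positive_if_contiguous_minors_pos:
  assumes A: "A \<in> carrier_mat n n"
    and contiguous: "\<And>k p q. 0 < k \<Longrightarrow> p + k \<le> n \<Longrightarrow> q + k \<le> n \<Longrightarrow>
      0 < det_fun k (\<lambda>i j. A $$ (p + i, q + j))"
  shows "totally_positive A"
  unfolding totally_positive_def
proof (intro allI impI, elim conjE)
  fix I J assume IJ: "I \<subseteq> {..<dim_row A}" "J \<subseteq> {..<dim_col A}" "card I = card J" "I \<noteq> {}"
  have pick: "strict_mono_on {..<card S} (pick S)" "pick S ` {..<card S} \<subseteq> S" for S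
    by (auto simp: strict_mono_on_def pick_mono pick_in_set)
  have "0 < det_fun (card I) (\<lambda>i j. A $$ (pick I i, pick J j))"
  proof (rule Fekete_criterion[where a = "\<lambda>i j. A $$ (i, j)" and n = n])
    show "strict_mono_on {..<card I} (pick I)" "strict_mono_on {..<card I} (pick J)"
      using pick(1)[of I] pick(1)[of J] IJ by simp_all
    show "pick I ` {..<card I} \<subseteq> {..<n}" "pick J ` {..<card I} \<subseteq> {..<n}"
      using pick(2)[of I] pick(2)[of J] IJ A by auto
  qed (rule contiguous)
  then show "0 < Determinant.det (submatrix A I J)"
    using IJ by (simp add: det_submatrix)
qed

text \<open>For fixed \<open>x\<close> the quadratic form is linear in the matrix, and an integrable
  function that is positive almost everywhere on a space of nonzero measure has positive
  integral.\<close>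

lemma pos_def_fun_integral:
  assumes "finite_measure M" "emeasure M (space M) \<noteq> 0"
    and int: "\<And>i j. i < k \<Longrightarrow> j < k \<Longrightarrow> integrable M (\<lambda>t. f t i j)"
    and pd: "AE t in M. pos_def_fun k (f t)"
  shows "pos_def_fun k (\<lambda>i j. LINT t|M. f t i j)"
  unfolding pos_def_fun_def
proof (intro allI impI)
  fix x :: "nat \<Rightarrow> real" assume x: "\<exists>i<k. x i \<noteq> 0"
  let ?Q = "\<lambda>t. \<Sum>i<k. \<Sum>j<k. f t i j * x i * x j"
  have "(LINT t|M. 0) < (LINT t|M. ?Q t)"
  proof (rule finite_measure.integral_less_AE_space)
    show "AE t in M. 0 < ?Q t"
      using pd by eventually_elim (use x in \<open>auto simp: pos_def_fun_def\<close>)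
  qed (use assms in \<open>auto intro!: Bochner_Integration.integrable_sum\<close>)
  also have "(LINT t|M. ?Q t) = (\<Sum>i<k. \<Sum>j<k. (LINT t|M. f t i j) * x i * x j)"
  proof -
    have "(LINT t|M. ?Q t) = (\<Sum>i<k. LINT t|M. (\<Sum>j<k. f t i j * x i * x j))"
      using int by (intro Bochner_Integration.integral_sum Bochner_Integration.integrable_sum) auto
    also have "\<dots> = (\<Sum>i<k. \<Sum>j<k. LINT t|M. f t i j * x i * x j)"
      using int by (intro sum.cong refl Bochner_Integration.integral_sum) auto
    finally show ?thesis by simp
  qed
  finally show "0 < (\<Sum>i<k. \<Sum>j<k. (LINT t|M. f t i j) * x i * x j)" by simp
qed

theorem theorem5:
  fixes n :: nat and A :: "real \<Rightarrow> real mat"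
  assumes carrier: "\<And>t. t \<in> {0..1} \<Longrightarrow> A t \<in> carrier_mat n n"
    and measurable: "\<And>i j. i < n \<Longrightarrow> j < n \<Longrightarrow>
      (\<lambda>t. A t $$ (i, j)) \<in> borel_measurable (lebesgue_on {0..1})"
    and bounded: "\<And>i j. i < n \<Longrightarrow> j < n \<Longrightarrow>
      (\<lambda>t. A t $$ (i, j)) \<in> Linfty (lebesgue_on {0..1})"
    and tp_hankel: "AE t in lebesgue_on {0..1}. totally_positive (A t) \<and> hankel_mat (A t)"
  shows "totally_positive (mat_integral (lebesgue_on {0..1}) n A)"
proof (rule totally_positive_if_contiguous_minors_pos)
  let ?M = "lebesgue_on {0..1::real}"
  show "mat_integral ?M n A \<in> carrier_mat n n"
    by (simp add: mat_integral_def)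
  have fin: "finite_measure ?M"
    by (rule finite_measure_lebesgue_on) simp
  have pos: "emeasure ?M (space ?M) \<noteq> 0"
    by (simp add: emeasure_restrict_space space_restrict_space)
  have int: "integrable ?M (\<lambda>t. A t $$ (i, j))" if ij: "i < n" "j < n" for i j
  proof -
    obtain C where "AE t in ?M. \<bar>A t $$ (i, j)\<bar> \<le> C"
      using bounded[OF ij] by (auto simp: Linfty_def)
    then show ?thesis
      using finite_measure.integrable_const_bound[OF fin _ measurable[OF ij], of C] by simp
  qed
  fix k p q :: nat assume k: "0 < k" "p + k \<le> n" "q + k \<le> n"
  let ?B = "\<lambda>i j. LINT t|?M. A t $$ (p + i, q + j)"
  have tph: "AE t in ?M. A t \<in> carrier_mat n n \<and> totally_positive (A t) \<and> hankel_mat (A t)"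
    using tp_hankel AE_space[of ?M] by eventually_elim (use carrier in auto)
  \<comment> \<open>Both entries have index sum \<open>p + q + i + j\<close>, so the block is
    symmetric even when \<open>p\<close> and \<open>q\<close> differ.\<close>
  have sym: "M $$ (p + i, q + j) = M $$ (p + j, q + i)"
    if "M \<in> carrier_mat n n" "hankel_mat M" "i < k" "j < k" for M :: "real mat" and i j
    using that k by (auto simp: hankel_mat_def)
  have "pos_def_fun k ?B"
  proof (rule pos_def_fun_integral[OF fin pos])
    show "AE t in ?M. pos_def_fun k (\<lambda>i j. A t $$ (p + i, q + j))"
      using tph
    proof eventually_elim
      case (elim t)
      \<comment> \<open>The leading minors of the block are contiguous minors of \<open>A t\<close>
        with the same corner \<open>(p, q)\<close>.\<close>
      have "0 < det_fun l (\<lambda>i j. A t $$ (p + i, q + j))" if "l \<in> {1..k}" for l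
        using that elim k by (intro totally_positive_contiguous_minor) auto
      moreover have "A t $$ (p + i, q + j) = A t $$ (p + j, q + i)" if "i < k" "j < k" for i j
        using sym elim that by blast
      ultimately show ?case
        using Sylvester_criterion[of k "\<lambda>i j. A t $$ (p + i, q + j)"] by blast
    qed
  qed (use int k in auto)
  moreover have "?B i j = ?B j i" if "i < k" "j < k" for i j
  proof (rule integral_cong_AE)
    show "AE t in ?M. A t $$ (p + i, q + j) = A t $$ (p + j, q + i)"
      using tph by eventually_elim (use sym that in blast)
  qed (use that k measurable in auto)
  \<comment> \<open>Sylvester's criterion in the other direction: the determinant of the block is
    its leading minor of order \<open>k\<close>.\<close>
  ultimately have "0 < det_fun k ?B"
    using Sylvester_criterion[of k ?B] k by auto
  also have "det_fun k ?B = det_fun k (\<lambda>i j. mat_integral ?M n A $$ (p + i, q + j))"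
    using k by (intro det_fun_cong) (simp add: mat_integral_def)
  finally show "0 < \<dots>" .
qed

end
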